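(* Let $\Gamma$ be a countable group and let $\varphi_o:\Gamma\to\mathbb{R}$ be a quasimorphism with $\varphi_o(e)=0$ which is not at bounded distance from a homomorphism $\Gamma\to\mathbb{R}$. Then the orbit closure $\Delta_{\varphi_o}$ is a compact metrizable subset of $[\varphi_o]$ which does not admit any $\Gamma$-invariant Borel probability measure.
   Context: $\varphi:\Gamma\to\mathbb{R}$ is a quasimorphism if $\sup_{g,h}|\varphi(gh)-\varphi(g)-\varphi(h)|<\infty$. Functions are at bounded distance if their difference is bounded. $\mathscr{F}_o(\Gamma):=\{\varphi\in\mathbb{R}^\Gamma\mid\varphi(e)=0\}$ carries the product topology and the continuous $\Gamma$-action $(\gamma.\varphi)(\gamma')=\varphi(\gamma'\gamma)-\varphi(\gamma)$. $[\varphi_o]$ is the set of all quasimorphisms $\varphi\in\mathscr{F}_o(\Gamma)$ at bounded distance from $\varphi_o$, and $\Delta_{\varphi_o}$ is the closure of the $\Gamma$-orbit of $\varphi_o$ in $\mathscr{F}_o(\Gamma)$. *)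

theory Defs
  imports "HOL-Algebra.Group" "HOL-Probability.Probability_Measure"
begin

definition real_add_group :: "real monoid" where
  "real_add_group = \<lparr>carrier = UNIV, monoid.mult = (+), one = 0\<rparr>"

definition quasimorphism :: "('a, 'b) monoid_scheme \<Rightarrow> ('a \<Rightarrow> real) \<Rightarrow> bool" where
  "quasimorphism G \<phi> \<longleftrightarrow>
     bdd_above ((\<lambda>(g, h). \<bar>\<phi> (g \<otimes>\<^bsub>G\<^esub> h) - \<phi> g - \<phi> h\<bar>) ` (carrier G \<times> carrier G))"

definition bounded_distance :: "('a, 'b) monoid_scheme \<Rightarrow> ('a \<Rightarrow> real) \<Rightarrow> ('a \<Rightarrow> real) \<Rightarrow> bool" where
  "bounded_distance G \<phi> \<psi> \<longleftrightarrow> bounded ((\<lambda>g. \<phi> g - \<psi> g) ` carrier G)"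

(* Functions on the group are represented extensionally (value undefined off the carrier), so
   that the points of the product topology over carrier G correspond exactly to real-valued
   functions on the group. *)
definition Fo :: "('a, 'b) monoid_scheme \<Rightarrow> ('a \<Rightarrow> real) set" where
  "Fo G = {\<phi> \<in> carrier G \<rightarrow>\<^sub>E UNIV. \<phi> \<one>\<^bsub>G\<^esub> = 0}"

definition Fo_topology :: "('a, 'b) monoid_scheme \<Rightarrow> ('a \<Rightarrow> real) topology" where
  "Fo_topology G = subtopology (product_topology (\<lambda>_. euclideanreal) (carrier G)) (Fo G)"

definition Fo_action :: "('a, 'b) monoid_scheme \<Rightarrow> 'a \<Rightarrow> ('a \<Rightarrow> real) \<Rightarrow> ('a \<Rightarrow> real)" where
  "Fo_action G \<gamma> \<phi> = (\<lambda>\<gamma>'\<in>carrier G. \<phi> (\<gamma>' \<otimes>\<^bsub>G\<^esub> \<gamma>) - \<phi> \<gamma>)"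

definition qm_class :: "('a, 'b) monoid_scheme \<Rightarrow> ('a \<Rightarrow> real) \<Rightarrow> ('a \<Rightarrow> real) set" where
  "qm_class G \<phi>\<^sub>o = {\<phi> \<in> Fo G. quasimorphism G \<phi> \<and> bounded_distance G \<phi> \<phi>\<^sub>o}"

definition orbit_closure :: "('a, 'b) monoid_scheme \<Rightarrow> ('a \<Rightarrow> real) \<Rightarrow> ('a \<Rightarrow> real) set" where
  "orbit_closure G \<phi>\<^sub>o = Fo_topology G closure_of ((\<lambda>\<gamma>. Fo_action G \<gamma> \<phi>\<^sub>o) ` carrier G)"

(* The library's borel is tied to the topology of a type class; this is the Borel sigma-algebra
   of an abstract topology. *)
definition borel_of :: "'a topology \<Rightarrow> 'a measure" where
  "borel_of X = sigma (topspace X) {U. openin X U}"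

definition borel_prob_on :: "'a topology \<Rightarrow> 'a measure \<Rightarrow> bool" where
  "borel_prob_on X \<mu> \<longleftrightarrow> sets \<mu> = sets (borel_of X) \<and> prob_space \<mu>"

definition action_invariant :: "('a, 'b) monoid_scheme \<Rightarrow> ('a \<Rightarrow> real) measure \<Rightarrow> bool" where
  "action_invariant G \<mu> \<longleftrightarrow>
     (\<forall>\<gamma>\<in>carrier G. \<forall>A\<in>sets \<mu>. emeasure \<mu> (Fo_action G \<gamma> -` A \<inter> space \<mu>) = emeasure \<mu> A)"

end

theory Submission
  imports Defs
begin

text \<open>Let \<open>D\<close> bound the defect of \<open>\<phi>\<^sub>o\<close>. Since
  \<open>(\<gamma>.\<phi>\<^sub>o)(x) - \<phi>\<^sub>o(x) = \<phi>\<^sub>o(x\<gamma>) - \<phi>\<^sub>o(\<gamma>) - \<phi>\<^sub>o(x)\<close>, the whole orbit of \<open>\<phi>\<^sub>o\<close> lies in the box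
  of functions within \<open>D\<close> of \<open>\<phi>\<^sub>o\<close> at every point. That box is compact by Tychonoff's theorem and
  closed, so it contains the orbit closure, which is therefore compact and consists of
  quasimorphisms at bounded distance from \<open>\<phi>\<^sub>o\<close>. The orbit closure is metrizable because a countable product of
  real lines is.

  Suppose \<open>\<mu>\<close> is an invariant probability measure on the orbit closure, and average:
  \<open>h(\<gamma>) = \<integral> \<phi>(\<gamma>) d\<mu>(\<phi>)\<close>. Invariance of \<open>\<mu>\<close> says that \<open>h(\<gamma>')\<close> is also the integral of
  \<open>(\<gamma>.\<phi>)(\<gamma>') = \<phi>(\<gamma>'\<gamma>) - \<phi>(\<gamma>)\<close>, that is, \<open>h(\<gamma>') = h(\<gamma>'\<gamma>) - h(\<gamma>)\<close>. So \<open>h\<close> is a homomorphism,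
  and it lies within \<open>D\<close> of \<open>\<phi>\<^sub>o\<close>, a contradiction.\<close>

section \<open>Measurability for the Borel sets of a topology\<close>

lemma space_borel_of [simp]: "space (borel_of X) = topspace X"
  by (simp add: borel_of_def space_measure_of_conv)

lemma sets_borel_of: "sets (borel_of X) = sigma_sets (topspace X) {U. openin X U}"
  unfolding borel_of_def by (rule sets_measure_of) (auto dest: openin_subset)

lemma openin_sets_borel_of: "openin X U \<Longrightarrow> U \<in> sets (borel_of X)"
  by (simp add: sets_borel_of sigma_sets.Basic)

lemma continuous_map_measurable_borel_of:
  assumes "continuous_map X Y f"
  shows "f \<in> measurable (borel_of X) (borel_of Y)"
proof (rule measurable_sigma_sets[OF sets_borel_of])
  show "{U. openin Y U} \<subseteq> Pow (topspace Y)" by (auto dest: openin_subset)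
  show "f \<in> space (borel_of X) \<rightarrow> topspace Y"
    using continuous_map_image_subset_topspace[OF assms] by auto
  fix U assume "U \<in> {U. openin Y U}"
  then have "openin X {x \<in> topspace X. f x \<in> U}"
    using assms openin_continuous_map_preimage by blast
  moreover have "f -` U \<inter> space (borel_of X) = {x \<in> topspace X. f x \<in> U}" by auto
  ultimately show "f -` U \<inter> space (borel_of X) \<in> sets (borel_of X)"
    by (simp add: openin_sets_borel_of)
qed

lemma sets_borel_of_euclideanreal: "sets (borel_of euclideanreal) = sets borel"
  by (simp add: sets_borel_of borel_def)

lemma continuous_map_real_measurable_borel_of:
  "continuous_map X euclideanreal f \<Longrightarrow> f \<in> borel_measurable (borel_of X)"
  using continuous_map_measurable_borel_of measurable_cong_sets sets_borel_of_euclideanreal by blast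

section \<open>The action on normalized functions\<close>

lemma topspace_Fo_topology [simp]: "topspace (Fo_topology G) = Fo G"
  by (auto simp: Fo_topology_def Fo_def)

lemma continuous_map_Fo_eval:
  assumes "x \<in> carrier G"
  shows "continuous_map (Fo_topology G) euclideanreal (\<lambda>\<phi>. \<phi> x)"
  unfolding Fo_topology_def
  by (intro continuous_map_from_subtopology continuous_map_product_projection assms)

lemma (in group) Fo_action_in_Fo:
  assumes "\<gamma> \<in> carrier G"
  shows "Fo_action G \<gamma> \<phi> \<in> Fo G"
  using assms by (auto simp: Fo_def Fo_action_def)

lemma (in group) continuous_map_Fo_action:
  assumes g: "\<gamma> \<in> carrier G"
  shows "continuous_map (Fo_topology G) (Fo_topology G) (Fo_action G \<gamma>)"
proof -
  have "continuous_map (Fo_topology G) euclideanreal (\<lambda>\<phi>. Fo_action G \<gamma> \<phi> x)"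
    if "x \<in> carrier G" for x
    using that g by (auto simp: Fo_action_def intro!: continuous_map_diff continuous_map_Fo_eval)
  then have "continuous_map (Fo_topology G)
      (product_topology (\<lambda>_. euclideanreal) (carrier G)) (Fo_action G \<gamma>)"
    by (subst continuous_map_componentwise) (auto simp: Fo_action_def)
  then show ?thesis
    using Fo_action_in_Fo[OF g]
    by (subst (2) Fo_topology_def) (auto simp: continuous_map_in_subtopology)
qed

lemma (in group) Fo_action_mult:
  assumes "\<gamma> \<in> carrier G" "\<delta> \<in> carrier G"
  shows "Fo_action G \<gamma> (Fo_action G \<delta> \<phi>) = Fo_action G (\<gamma> \<otimes> \<delta>) \<phi>"
  using assms by (auto simp: Fo_action_def m_assoc)

lemma (in group) orbit_closure_invariant:
  assumes g: "\<gamma> \<in> carrier G"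
  shows "Fo_action G \<gamma> ` orbit_closure G \<phi>\<^sub>o \<subseteq> orbit_closure G \<phi>\<^sub>o"
proof -
  let ?O = "(\<lambda>\<gamma>. Fo_action G \<gamma> \<phi>\<^sub>o) ` carrier G"
  have "Fo_action G \<gamma> ` ?O \<subseteq> ?O"
    using g by (auto simp: Fo_action_mult)
  then show ?thesis
    using continuous_map_image_closure_subset[OF continuous_map_Fo_action[OF g], of ?O]
      closure_of_mono[of "Fo_action G \<gamma> ` ?O" ?O "Fo_topology G"]
    unfolding orbit_closure_def by blast
qed

section \<open>Compactness and metrizability of the orbit closure\<close>

text \<open>The normalized functions that stay within distance \<open>D\<close> of a given function.\<close>
definition Fo_box :: "('a, 'b) monoid_scheme \<Rightarrow> ('a \<Rightarrow> real) \<Rightarrow> real \<Rightarrow> ('a \<Rightarrow> real) set" where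
  "Fo_box G \<phi>\<^sub>o D = {\<phi> \<in> Fo G. \<forall>x\<in>carrier G. \<bar>\<phi> x - \<phi>\<^sub>o x\<bar> \<le> D}"

lemma closedin_Fo_box: "closedin (Fo_topology G) (Fo_box G \<phi>\<^sub>o D)"
proof (cases "carrier G = {}")
  \<comment> \<open>An intersection over the empty carrier would be the whole type instead of \<open>Fo G\<close>.\<close>
  case True
  then show ?thesis
    using closedin_topspace[of "Fo_topology G"] by (simp add: Fo_box_def)
next
  case False
  have "closedin (Fo_topology G) {\<phi> \<in> topspace (Fo_topology G). \<phi> x \<in> {\<phi>\<^sub>o x - D..\<phi>\<^sub>o x + D}}"
    if "x \<in> carrier G" for x
    by (rule closedin_continuous_map_preimage[OF continuous_map_Fo_eval[OF that]]) simp
  then have "closedin (Fo_topology G)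
      (\<Inter>x\<in>carrier G. {\<phi> \<in> topspace (Fo_topology G). \<phi> x \<in> {\<phi>\<^sub>o x - D..\<phi>\<^sub>o x + D}})"
    using False by (intro closedin_INT) auto
  also have "(\<Inter>x\<in>carrier G. {\<phi> \<in> topspace (Fo_topology G). \<phi> x \<in> {\<phi>\<^sub>o x - D..\<phi>\<^sub>o x + D}})
      = Fo_box G \<phi>\<^sub>o D"
    using False by (auto simp: Fo_box_def abs_le_iff algebra_simps)
  finally show ?thesis .
qed

lemma (in group) compactin_Fo_box: "compactin (Fo_topology G) (Fo_box G \<phi>\<^sub>o D)"
proof -
  let ?P = "product_topology (\<lambda>_. euclideanreal) (carrier G)"
  let ?B = "\<Pi>\<^sub>E x\<in>carrier G. {\<phi>\<^sub>o x - D..\<phi>\<^sub>o x + D}"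
  have "compactin ?P ?B"
    by (simp add: compactin_PiE)
  moreover have "closedin ?P {\<phi> \<in> topspace ?P. \<phi> \<one> \<in> {0}}"
    by (rule closedin_continuous_map_preimage[OF continuous_map_product_projection]) auto
  ultimately have "compactin ?P ({\<phi> \<in> topspace ?P. \<phi> \<one> \<in> {0}} \<inter> ?B)"
    by (rule closed_Int_compactin[rotated])
  also have "{\<phi> \<in> topspace ?P. \<phi> \<one> \<in> {0}} \<inter> ?B = Fo_box G \<phi>\<^sub>o D"
  proof -
    have "\<bar>a - b\<bar> \<le> D \<longleftrightarrow> a \<in> {b - D..b + D}" for a b :: real
      by auto
    then show ?thesis
      unfolding Fo_box_def Fo_def by (auto simp: PiE_def Pi_def)
  qed
  finally show ?thesis
    by (auto simp: Fo_topology_def compactin_subtopology Fo_box_def)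
qed

lemma metrizable_space_Fo_topology:
  assumes "countable (carrier G)"
  shows "metrizable_space (Fo_topology G)"
  unfolding Fo_topology_def
proof (rule metrizable_space_subtopology)
  have "countable {i \<in> carrier G. \<not> (\<exists>a. topspace euclideanreal \<subseteq> {a})}"
    by (rule countable_subset[OF _ assms]) auto
  then show "metrizable_space (product_topology (\<lambda>_. euclideanreal) (carrier G))"
    by (simp add: metrizable_space_product_topology metrizable_space_euclidean)
qed

lemma quasimorphismE:
  assumes "quasimorphism G \<phi>"
  obtains D where "\<And>g h. g \<in> carrier G \<Longrightarrow> h \<in> carrier G \<Longrightarrow> \<bar>\<phi> (g \<otimes>\<^bsub>G\<^esub> h) - \<phi> g - \<phi> h\<bar> \<le> D"
proof -
  obtain D where "\<forall>y\<in>(\<lambda>(g, h). \<bar>\<phi> (g \<otimes>\<^bsub>G\<^esub> h) - \<phi> g - \<phi> h\<bar>) ` (carrier G \<times> carrier G). y \<le> D"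
    using assms unfolding quasimorphism_def bdd_above_def by blast
  then show ?thesis
    by (intro that[of D]) (simp add: ball_simps)
qed

lemma (in group) orbit_closure_subset_Fo_box:
  assumes D: "\<And>g h. g \<in> carrier G \<Longrightarrow> h \<in> carrier G \<Longrightarrow> \<bar>\<phi>\<^sub>o (g \<otimes> h) - \<phi>\<^sub>o g - \<phi>\<^sub>o h\<bar> \<le> D"
  shows "orbit_closure G \<phi>\<^sub>o \<subseteq> Fo_box G \<phi>\<^sub>o D"
  unfolding orbit_closure_def
proof (rule closure_of_minimal[OF _ closedin_Fo_box], clarify)
  fix g assume g: "g \<in> carrier G"
  have "\<bar>Fo_action G g \<phi>\<^sub>o x - \<phi>\<^sub>o x\<bar> \<le> D" if "x \<in> carrier G" for x
    using D[OF that g] that by (simp add: Fo_action_def algebra_simps)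
  then show "Fo_action G g \<phi>\<^sub>o \<in> Fo_box G \<phi>\<^sub>o D"
    by (simp add: Fo_box_def Fo_action_in_Fo g)
qed

text \<open>A function within \<open>D\<close> of a quasimorphism of defect at most \<open>E\<close> has defect at most
  \<open>E + 3 * D\<close>.\<close>
lemma (in group) Fo_box_subset_qm_class:
  assumes "quasimorphism G \<phi>\<^sub>o"
  shows "Fo_box G \<phi>\<^sub>o D \<subseteq> qm_class G \<phi>\<^sub>o"
proof
  fix \<phi> assume \<phi>: "\<phi> \<in> Fo_box G \<phi>\<^sub>o D"
  obtain E where
    E: "\<And>g h. g \<in> carrier G \<Longrightarrow> h \<in> carrier G \<Longrightarrow> \<bar>\<phi>\<^sub>o (g \<otimes> h) - \<phi>\<^sub>o g - \<phi>\<^sub>o h\<bar> \<le> E"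
    using quasimorphismE[OF assms] by blast
  have close: "\<bar>\<phi> x - \<phi>\<^sub>o x\<bar> \<le> D" if "x \<in> carrier G" for x
    using \<phi> that by (simp add: Fo_box_def)
  have "\<bar>\<phi> (g \<otimes> h) - \<phi> g - \<phi> h\<bar> \<le> E + 3 * D" if "g \<in> carrier G" "h \<in> carrier G" for g h
    using E[OF that] close[OF that(1)] close[OF that(2)] close[OF m_closed[OF that]] by linarith
  then have "quasimorphism G \<phi>"
    unfolding quasimorphism_def by (intro bdd_aboveI[of _ "E + 3 * D"]) auto
  moreover have "bounded_distance G \<phi> \<phi>\<^sub>o"
    unfolding bounded_distance_def using close by (auto intro!: boundedI[of _ D])
  ultimately show "\<phi> \<in> qm_class G \<phi>\<^sub>o"
    using \<phi> by (simp add: qm_class_def Fo_box_def)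
qed

section \<open>Averaging over an invariant measure\<close>

text \<open>The averaging argument works for any subset of the box that is stable under the action:
  the box bounds the evaluations, hence makes them integrable, and keeps the average near
  \<open>\<phi>\<^sub>o\<close>.\<close>
lemma (in group) invariant_measure_imp_near_hom:
  assumes subset: "S \<subseteq> Fo_box G \<phi>\<^sub>o D"
    and stable: "\<And>\<gamma>. \<gamma> \<in> carrier G \<Longrightarrow> Fo_action G \<gamma> ` S \<subseteq> S"
    and borel: "borel_prob_on (subtopology (Fo_topology G) S) \<mu>"
    and inv: "action_invariant G \<mu>"
  shows "\<exists>h\<in>hom G real_add_group. bounded_distance G \<phi>\<^sub>o h"
proof -
  let ?X = "subtopology (Fo_topology G) S"
  have sets: "sets \<mu> = sets (borel_of ?X)" and "prob_space \<mu>"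
    using borel by (auto simp: borel_prob_on_def)
  interpret prob_space \<mu> by fact
  have space: "space \<mu> = S"
    using sets_eq_imp_space_eq[OF sets] subset by (auto simp: Fo_box_def)
  have eval: "(\<lambda>\<phi>. \<phi> x) \<in> borel_measurable \<mu>" if "x \<in> carrier G" for x
    using continuous_map_real_measurable_borel_of[OF
        continuous_map_from_subtopology[OF continuous_map_Fo_eval[OF that], of S]]
    by (simp add: measurable_cong_sets[OF sets refl])
  \<comment> \<open>Stability of \<open>S\<close> makes the action a measurable self-map of \<open>S\<close>, so invariance can be
    restated as \<open>\<mu>\<close> being its own image measure.\<close>
  have act: "Fo_action G \<gamma> \<in> measurable \<mu> \<mu>" if "\<gamma> \<in> carrier G" for \<gamma>
  proof -
    have "continuous_map ?X ?X (Fo_action G \<gamma>)"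
      using continuous_map_from_subtopology[OF continuous_map_Fo_action[OF that], of S] stable[OF that]
      by (auto simp: continuous_map_in_subtopology)
    then show ?thesis
      using continuous_map_measurable_borel_of by (simp add: measurable_cong_sets[OF sets sets])
  qed
  have distr: "distr \<mu> \<mu> (Fo_action G \<gamma>) = \<mu>" if "\<gamma> \<in> carrier G" for \<gamma>
    using inv that by (intro measure_eqI) (auto simp: emeasure_distr act action_invariant_def)
  have close: "\<bar>\<phi> x - \<phi>\<^sub>o x\<bar> \<le> D" if "\<phi> \<in> S" "x \<in> carrier G" for \<phi> x
    using that subset by (auto simp: Fo_box_def)
  have int: "integrable \<mu> (\<lambda>\<phi>. \<phi> x)" if x: "x \<in> carrier G" for x
  proof (rule integrable_const_bound[of _ "\<bar>\<phi>\<^sub>o x\<bar> + D"])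
    show "AE \<phi> in \<mu>. norm (\<phi> x) \<le> \<bar>\<phi>\<^sub>o x\<bar> + D"
      using close[OF _ x] by (intro AE_I2) (force simp: space)
  qed (rule eval[OF x])
  define h where "h x = (\<integral>\<phi>. \<phi> x \<partial>\<mu>)" for x
  have "h (x \<otimes> y) = h x + h y" if x: "x \<in> carrier G" and y: "y \<in> carrier G" for x y
  proof -
    have "h x = (\<integral>\<phi>. \<phi> x \<partial>distr \<mu> \<mu> (Fo_action G y))"
      by (simp add: h_def distr y)
    also have "\<dots> = (\<integral>\<phi>. Fo_action G y \<phi> x \<partial>\<mu>)"
      by (rule integral_distr[OF act[OF y] eval[OF x]])
    also have "\<dots> = (\<integral>\<phi>. \<phi> (x \<otimes> y) - \<phi> y \<partial>\<mu>)"
      using x by (simp add: Fo_action_def)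
    also have "\<dots> = h (x \<otimes> y) - h y"
      unfolding h_def using x y by (intro Bochner_Integration.integral_diff int) auto
    finally show ?thesis by simp
  qed
  then have "h \<in> hom G real_add_group"
    by (auto simp: hom_def real_add_group_def)
  moreover have "\<bar>\<phi>\<^sub>o x - h x\<bar> \<le> D" if x: "x \<in> carrier G" for x
  proof -
    have "h x \<le> \<phi>\<^sub>o x + D"
      unfolding h_def using close[OF _ x]
      by (intro integral_le_const int x AE_I2) (force simp: space abs_le_iff)
    moreover have "\<phi>\<^sub>o x - D \<le> h x"
      unfolding h_def using close[OF _ x]
      by (intro integral_ge_const int x AE_I2) (force simp: space abs_le_iff)
    ultimately show ?thesis by linarith
  qed
  then have "bounded_distance G \<phi>\<^sub>o h"
    unfolding bounded_distance_def by (auto intro!: boundedI[of _ D])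
  ultimately show ?thesis by blast
qed

section \<open>Orbit closures of nontrivial quasimorphisms\<close>

theorem proposition1p8:
  fixes G :: "('a, 'b) monoid_scheme" and \<phi>\<^sub>o :: "'a \<Rightarrow> real"
  assumes "group G"
    and "countable (carrier G)"
    and "\<phi>\<^sub>o \<in> carrier G \<rightarrow>\<^sub>E UNIV"
    and "quasimorphism G \<phi>\<^sub>o"
    and "\<phi>\<^sub>o \<one>\<^bsub>G\<^esub> = 0"
    and "\<not> (\<exists>h\<in>hom G real_add_group. bounded_distance G \<phi>\<^sub>o h)"
  shows "compactin (Fo_topology G) (orbit_closure G \<phi>\<^sub>o)
    \<and> metrizable_space (subtopology (Fo_topology G) (orbit_closure G \<phi>\<^sub>o))
    \<and> orbit_closure G \<phi>\<^sub>o \<subseteq> qm_class G \<phi>\<^sub>o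
    \<and> \<not> (\<exists>\<mu>. borel_prob_on (subtopology (Fo_topology G) (orbit_closure G \<phi>\<^sub>o)) \<mu>
             \<and> action_invariant G \<mu>)"
proof -
  interpret group G by fact
  obtain D where
    D: "\<And>g h. g \<in> carrier G \<Longrightarrow> h \<in> carrier G \<Longrightarrow> \<bar>\<phi>\<^sub>o (g \<otimes>\<^bsub>G\<^esub> h) - \<phi>\<^sub>o g - \<phi>\<^sub>o h\<bar> \<le> D"
    using quasimorphismE[OF assms(4)] by blast
  have box: "orbit_closure G \<phi>\<^sub>o \<subseteq> Fo_box G \<phi>\<^sub>o D"
    using D by (rule orbit_closure_subset_Fo_box)
  have "compactin (Fo_topology G) (orbit_closure G \<phi>\<^sub>o)"
    by (rule closed_compactin[OF compactin_Fo_box box]) (simp add: orbit_closure_def)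
  moreover have "metrizable_space (subtopology (Fo_topology G) (orbit_closure G \<phi>\<^sub>o))"
    by (intro metrizable_space_subtopology metrizable_space_Fo_topology assms(2))
  moreover have "orbit_closure G \<phi>\<^sub>o \<subseteq> qm_class G \<phi>\<^sub>o"
    using box Fo_box_subset_qm_class[OF assms(4)] by blast
  moreover have "\<not> (\<exists>\<mu>. borel_prob_on (subtopology (Fo_topology G) (orbit_closure G \<phi>\<^sub>o)) \<mu>
             \<and> action_invariant G \<mu>)"
    using invariant_measure_imp_near_hom[OF box orbit_closure_invariant] assms(6) by blast
  ultimately show ?thesis by blast
qed

end
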